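(* Let $q\ge 1$, $d\ge 1$ and $t\ge 0$ be integers, and let $C\subset Q_q^d$ be a code with distance $t+1$. Then there exist an integer $q'\geq q$ and an $MDS(t,d,q')$ code $M$ such that $C\subseteq M\subset Q_{q'}^d$.
   Context: $Q_q=\{0,\dots,q-1\}$, and $Q_q^d$ is equipped with the Hamming distance $\rho$ (number of coordinates in which two tuples differ). A subset $C\subseteq Q_q^d$ is a code with distance $t+1$ if $\min\{\rho(x,y): x,y\in C,\ x\ne y\}=t+1$. A subset $M\subseteq Q_q^d$ is an $MDS(t,d,q)$ code if $|M\cap\Gamma|=1$ for every $t$-dimensional axis-aligned plane $\Gamma$ of $Q_q^d$ (i.e. every set obtained by fixing $d-t$ coordinates and letting the other $t$ coordinates range freely over $Q_q$). For $q\le q'$ we regard $Q_q\subseteq Q_{q'}$ and hence $Q_q^d\subseteq Q_{q'}^d$. *)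

theory Defs
  imports Main "HOL-Library.FuncSet"
begin

text \<open>
  Tuples over \<open>{0, \<dots>, q - 1}\<close> are extensional functions on the coordinate set \<open>{..<d}\<close>.
  For \<open>q \<le> q'\<close> the inclusion \<open>cube q d \<subseteq> cube q' d\<close> therefore holds literally,
  without an embedding map.
\<close>

definition cube :: "nat \<Rightarrow> nat \<Rightarrow> (nat \<Rightarrow> nat) set" where
  "cube q d = {..<d} \<rightarrow>\<^sub>E {..<q}"

definition hamming :: "nat \<Rightarrow> (nat \<Rightarrow> nat) \<Rightarrow> (nat \<Rightarrow> nat) \<Rightarrow> nat" where
  "hamming d x y = card {i \<in> {..<d}. x i \<noteq> y i}"

definition distances :: "nat \<Rightarrow> (nat \<Rightarrow> nat) set \<Rightarrow> nat set" where
  "distances d C = {hamming d x y |x y. x \<in> C \<and> y \<in> C \<and> x \<noteq> y}"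

text \<open>
  The minimum must exist, so a code has at least two elements; \<open>Min {}\<close> is unspecified,
  hence the explicit nonemptiness condition.
\<close>

definition is_code :: "nat \<Rightarrow> nat \<Rightarrow> nat \<Rightarrow> (nat \<Rightarrow> nat) set \<Rightarrow> bool" where
  "is_code q d \<delta> C \<longleftrightarrow>
     C \<subseteq> cube q d \<and> distances d C \<noteq> {} \<and> Min (distances d C) = \<delta>"

text \<open>\<open>T\<close> is the set of free coordinates; the others are fixed to the values of \<open>a\<close>.\<close>

definition is_plane :: "nat \<Rightarrow> nat \<Rightarrow> nat \<Rightarrow> (nat \<Rightarrow> nat) set \<Rightarrow> bool" where
  "is_plane t d q \<Gamma> \<longleftrightarrow>
     (\<exists>T a. T \<subseteq> {..<d} \<and> card T = t \<and> a \<in> cube q d \<and>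
        \<Gamma> = {x \<in> cube q d. \<forall>i \<in> {..<d} - T. x i = a i})"

definition is_MDS :: "nat \<Rightarrow> nat \<Rightarrow> nat \<Rightarrow> (nat \<Rightarrow> nat) set \<Rightarrow> bool" where
  "is_MDS t d q M \<longleftrightarrow>
     M \<subseteq> cube q d \<and> (\<forall>\<Gamma>. is_plane t d q \<Gamma> \<longrightarrow> card (M \<inter> \<Gamma>) = 1)"

end

theory Submission
  imports Defs "HOL-Library.Z2" "HOL-Algebra.Algebraic_Closure_Type"
begin

text \<open>
  Let \<open>k = d - t\<close>, and let \<open>E\<close> be a linear MDS code of length \<open>d\<close> and dimension \<open>k\<close> over a finite
  field \<open>F\<close>. Take as new alphabet the space \<open>V\<close> with one basis vector \<open>e i a\<close> per coordinate \<open>i\<close> and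
  letter \<open>a\<close>; the words over \<open>V\<close> all of whose scalar components lie in \<open>E\<close> form an MDS code. For
  \<open>c \<in> C\<close> let \<open>L c\<close> be the space of all \<open>\<Sum>j. m j * e j (c j)\<close> with \<open>m\<close> in the dual code of \<open>E\<close>. The
  encoded word of \<open>c\<close> lies in the box with sides \<open>e i (c i) + L c\<close>, and the big code meets this box in an
  MDS code, which may be switched to the MDS code \<open>e + (E \<otimes> L c)\<close> containing the encoded word \<open>e\<close>. As
  distinct \<open>c, c' \<in> C\<close> agree in fewer than \<open>k\<close> coordinates while nonzero dual words have weight
  greater than \<open>k\<close>, the two boxes have disjoint sides wherever \<open>c\<close> and \<open>c'\<close> differ, so that all switches
  can be made simultaneously.
\<close>

subsection \<open>Switching in MDS codes\<close>

text \<open>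
  Unlike \<open>is_MDS\<close>, this variant is indexed by the number \<open>k = d - t\<close> of fixed coordinates and allows
  a different alphabet at each coordinate.
\<close>

definition mds :: "nat \<Rightarrow> nat \<Rightarrow> (nat \<Rightarrow> 'v set) \<Rightarrow> (nat \<Rightarrow> 'v) set \<Rightarrow> bool" where
  "mds k d A M \<longleftrightarrow> M \<subseteq> PiE {..<d} A \<and>
     (\<forall>K v. K \<subseteq> {..<d} \<longrightarrow> card K = k \<longrightarrow> v \<in> Pi K A \<longrightarrow> (\<exists>!x. x \<in> M \<and> (\<forall>i\<in>K. x i = v i)))"

lemma mdsI:
  assumes "M \<subseteq> PiE {..<d} A"
    and "\<And>K v. K \<subseteq> {..<d} \<Longrightarrow> card K = k \<Longrightarrow> v \<in> Pi K A \<Longrightarrow> \<exists>x\<in>M. \<forall>i\<in>K. x i = v i"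
    and "\<And>K x y. K \<subseteq> {..<d} \<Longrightarrow> card K = k \<Longrightarrow> x \<in> M \<Longrightarrow> y \<in> M \<Longrightarrow> \<forall>i\<in>K. x i = y i \<Longrightarrow> x = y"
  shows "mds k d A M"
  unfolding mds_def
proof (intro conjI allI impI)
  fix K v assume K: "K \<subseteq> {..<d}" "card K = k" "v \<in> Pi K A"
  obtain x where x: "x \<in> M" "\<forall>i\<in>K. x i = v i"
    using assms(2)[OF K] by blast
  show "\<exists>!x. x \<in> M \<and> (\<forall>i\<in>K. x i = v i)"
    using x assms(3)[OF K(1,2)] by (intro ex1I[of _ x]) auto
qed (rule assms(1))

lemma mds_subset: "mds k d A M \<Longrightarrow> x \<in> M \<Longrightarrow> x \<in> PiE {..<d} A"
  by (auto simp: mds_def)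

lemma mds_ex:
  assumes "mds k d A M" "K \<subseteq> {..<d}" "card K = k" "v \<in> Pi K A"
  obtains x where "x \<in> M" "\<forall>i\<in>K. x i = v i"
proof -
  have "\<exists>!x. x \<in> M \<and> (\<forall>i\<in>K. x i = v i)"
    using assms unfolding mds_def by blast
  then show thesis using that by blast
qed

lemma mds_unique:
  assumes "mds k d A M" "K \<subseteq> {..<d}" "card K = k" "x \<in> M" "y \<in> M" "\<forall>i\<in>K. x i = y i"
  shows "x = y"
proof -
  have "y \<in> Pi K A"
    using mds_subset[OF assms(1,5)] assms(2) by fastforce
  then have "\<exists>!z. z \<in> M \<and> (\<forall>i\<in>K. z i = y i)"
    using assms(1,2,3) unfolding mds_def by blast
  then show ?thesis
    using assms(4-6) by blast
qed

text \<open>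
  Subcodes on boxes \<open>B c\<close> may be exchanged independently for other MDS codes on these boxes, since
  words in two different boxes share fewer than \<open>k\<close> symbols.
\<close>

lemma mds_switch:
  assumes M: "mds k d A M"
    and sub: "\<And>c i. c \<in> C \<Longrightarrow> i < d \<Longrightarrow> B c i \<subseteq> A i"
    and MB: "\<And>c. c \<in> C \<Longrightarrow> mds k d (B c) (M \<inter> PiE {..<d} (B c))"
    and S: "\<And>c. c \<in> C \<Longrightarrow> mds k d (B c) (S c)"
    and disj: "\<And>c c' K. c \<in> C \<Longrightarrow> c' \<in> C \<Longrightarrow> c \<noteq> c' \<Longrightarrow> K \<subseteq> {..<d} \<Longrightarrow> card K = k \<Longrightarrow>
      \<exists>i\<in>K. B c i \<inter> B c' i = {}"
  shows "mds k d A (M - (\<Union>c\<in>C. PiE {..<d} (B c)) \<union> (\<Union>c\<in>C. S c))"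
    (is "mds k d A ?N")
proof (rule mdsI)
  have "x \<in> PiE {..<d} A" if "c \<in> C" "x \<in> S c" for c x
    using PiE_mono[of "{..<d}" "B c" A] mds_subset[OF S] sub that by auto
  then show "?N \<subseteq> PiE {..<d} A"
    using mds_subset[OF M] by auto
next
  fix K v assume K: "K \<subseteq> {..<d}" "card K = k" and v: "v \<in> Pi K A"
  obtain x where x: "x \<in> M" "\<forall>i\<in>K. x i = v i"
    using mds_ex[OF M K v] .
  show "\<exists>x\<in>?N. \<forall>i\<in>K. x i = v i"
  proof (cases "\<exists>c\<in>C. x \<in> PiE {..<d} (B c)")
    case True
    then obtain c where c: "c \<in> C" "x \<in> PiE {..<d} (B c)" by blast
    \<comment> \<open>The symbols of \<open>x\<close> on \<open>K\<close> lie in the sides of the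
      removed box, so \<open>S c\<close> supplies a replacement.\<close>
    then have "v \<in> Pi K (B c)"
      using K(1) x(2) by (auto simp: Pi_iff PiE_iff subset_eq dest!: bspec)
    then obtain y where "y \<in> S c" "\<forall>i\<in>K. y i = v i"
      using mds_ex[OF S[OF c(1)] K] by blast
    then show ?thesis using c(1) by blast
  next
    case False
    then show ?thesis using x by blast
  qed
next
  fix K x y
  assume K: "K \<subseteq> {..<d}" "card K = k" and xy: "x \<in> ?N" "y \<in> ?N" "\<forall>i\<in>K. x i = y i"
  \<comment> \<open>\<open>M\<close> has a word \<open>s\<close> in the box with the symbols of
    \<open>u\<close> on \<open>K\<close>. Then \<open>s\<close> and \<open>w\<close> are words of
    \<open>M\<close> agreeing on \<open>K\<close>, hence equal, but \<open>w\<close> lies outside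
    the box.\<close>
  have mixed: False
    if c: "c \<in> C" and u: "u \<in> S c" and w: "w \<in> M" "w \<notin> PiE {..<d} (B c)" "\<forall>i\<in>K. u i = w i" for c u w
  proof -
    have "u \<in> Pi K (B c)"
      using mds_subset[OF S[OF c] u] K(1) by fastforce
    then obtain s where "s \<in> M \<inter> PiE {..<d} (B c)" "\<forall>i\<in>K. s i = u i"
      using mds_ex[OF MB[OF c] K] by blast
    then show False
      using mds_unique[OF M K, of s w] w by auto
  qed
  have switched: "x = y" if c: "c \<in> C" "x \<in> S c" and c': "c' \<in> C" "y \<in> S c'" for c c'
  proof (cases "c = c'")
    case True
    then show ?thesis
      using mds_unique[OF S[OF c(1)] K c(2)] c' xy(3) by blast
  next
    case False
    then obtain i where i: "i \<in> K" "B c i \<inter> B c' i = {}"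
      using disj[OF c(1) c'(1) _ K] by blast
    then have "x i \<in> B c i" "y i \<in> B c' i"
      using mds_subset[OF S[OF c(1)] c(2)] mds_subset[OF S[OF c'(1)] c'(2)] K(1) by auto
    then show ?thesis using i xy(3) by auto
  qed
  show "x = y"
    using xy(1,2)
  proof (elim UnE UN_E)
    assume "x \<in> M - (\<Union>c\<in>C. PiE {..<d} (B c))" "y \<in> M - (\<Union>c\<in>C. PiE {..<d} (B c))"
    then show ?thesis using mds_unique[OF M K] xy(3) by blast
  next
    fix c assume "x \<in> M - (\<Union>c\<in>C. PiE {..<d} (B c))" "c \<in> C" "y \<in> S c"
    then show ?thesis using mixed[of c y x] xy(3) by auto
  next
    fix c assume "y \<in> M - (\<Union>c\<in>C. PiE {..<d} (B c))" "c \<in> C" "x \<in> S c"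
    then show ?thesis using mixed[of c x y] xy(3) by auto
  qed (rule switched)
qed

section \<open>Relabelling the alphabet by numbers\<close>

lemma is_MDS_image:
  assumes M: "mds k d (\<lambda>_. V) M" and h: "\<And>i. i < d \<Longrightarrow> bij_betw (h i) V {..<n}" and kt: "k + t = d"
  shows "is_MDS t d n ((\<lambda>x. \<lambda>i\<in>{..<d}. h i (x i)) ` M)"
  unfolding is_MDS_def
proof (intro conjI allI impI)
  let ?H = "\<lambda>x. \<lambda>i\<in>{..<d}. h i (x i)"
  have hV: "h i v < n" if "i < d" "v \<in> V" for i v
    using h[OF that(1)] that(2) by (auto simp: bij_betw_def)
  show sub: "?H ` M \<subseteq> cube n d"
  proof (rule image_subsetI)
    fix x assume "x \<in> M"
    then have "x \<in> {..<d} \<rightarrow>\<^sub>E V" using mds_subset[OF M] by blast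
    then show "?H x \<in> cube n d"
      unfolding cube_def restrict_PiE_iff using hV by auto
  qed
  fix \<Gamma> assume "is_plane t d n \<Gamma>"
  then obtain T a where T: "T \<subseteq> {..<d}" "card T = t" and a: "a \<in> cube n d"
    and \<Gamma>: "\<Gamma> = {x \<in> cube n d. \<forall>i \<in> {..<d} - T. x i = a i}"
    unfolding is_plane_def by blast
  \<comment> \<open>These are the \<open>k = d - t\<close> coordinates fixed by the plane; their
    values, pulled back along \<open>h\<close>, determine one word of \<open>M\<close>.\<close>
  define K where "K = {..<d} - T"
  have K: "K \<subseteq> {..<d}" "card K = k"
    using T kt card_Diff_subset[OF finite_subset[OF T(1) finite_lessThan] T(1)] by (auto simp: K_def)
  define v where "v i = inv_into V (h i) (a i)" for i
  have v: "v i \<in> V" "h i (v i) = a i" if "i \<in> K" for i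
  proof -
    have "i < d" using that K(1) by auto
    then have "a i \<in> h i ` V"
      using a h[of i] by (auto simp: cube_def bij_betw_def)
    then show "v i \<in> V" "h i (v i) = a i"
      by (auto simp: v_def inv_into_into f_inv_into_f)
  qed
  obtain x where x: "x \<in> M" "\<forall>i\<in>K. x i = v i"
    using mds_ex[OF M K, of v] v by auto
  have "?H ` M \<inter> \<Gamma> = {?H x}"
  proof (intro equalityI subsetI)
    fix z assume "z \<in> ?H ` M \<inter> \<Gamma>"
    then obtain y where y: "y \<in> M" "z = ?H y" and z: "\<forall>i\<in>K. z i = a i"
      by (auto simp: \<Gamma> K_def)
    have "y i = x i" if i: "i \<in> K" for i
    proof -
      have "i < d" using i K(1) by auto
      then have "y i \<in> V" "h i (y i) = h i (v i)"
        using mds_subset[OF M y(1)] bspec[OF z i] y(2) v(2)[OF i] by auto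
      then show ?thesis
        using h[OF \<open>i < d\<close>] v(1)[OF i] x(2) i by (auto simp: bij_betw_def inj_on_def)
    qed
    then show "z \<in> {?H x}"
      using mds_unique[OF M K y(1) x(1)] y(2) by blast
  next
    fix z assume "z \<in> {?H x}"
    moreover have "?H x i = a i" if "i \<in> K" for i
    proof -
      have "i < d" using that K(1) by auto
      then show ?thesis using that x(2) v(2) by auto
    qed
    ultimately show "z \<in> ?H ` M \<inter> \<Gamma>"
      using x(1) sub by (auto simp: \<Gamma> K_def)
  qed
  then show "card (?H ` M \<inter> \<Gamma>) = 1" by simp
qed

text \<open>Lets the new alphabet be numbered so that each encoded letter \<open>e a\<close> gets
  its old number \<open>a\<close> back; the original code is then contained literally.\<close>

lemma bij_betw_extend_inj:
  assumes "finite V" "inj_on e {..<q}" "e ` {..<q} \<subseteq> V"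
  shows "\<exists>h. bij_betw h V {..<card V} \<and> (\<forall>a<q. h (e a) = a)"
proof -
  have card: "card (e ` {..<q}) = q"
    using assms(2) by (simp add: card_image)
  then have "q \<le> card V"
    using card_mono[OF assms(1,3)] by simp
  have "card (V - e ` {..<q}) = card {q..<card V}"
    using assms(3) card by (simp add: card_Diff_subset)
  then obtain g where g: "bij_betw g (V - e ` {..<q}) {q..<card V}"
    using assms(1) by (metis finite_Diff finite_atLeastLessThan finite_same_card_bij)
  define h where "h v = (if v \<in> e ` {..<q} then inv_into {..<q} e v else g v)" for v
  have "bij_betw h (e ` {..<q}) {..<q}"
    using bij_betw_inv_into[OF inj_on_imp_bij_betw[OF assms(2)]]
    by (rule bij_betw_cong[THEN iffD2, rotated]) (simp add: h_def)
  moreover have "bij_betw h (V - e ` {..<q}) {q..<card V}"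
    using g by (rule bij_betw_cong[THEN iffD2, rotated]) (simp add: h_def)
  ultimately have "bij_betw h (e ` {..<q} \<union> (V - e ` {..<q})) ({..<q} \<union> {q..<card V})"
    by (rule bij_betw_combine) auto
  moreover have "e ` {..<q} \<union> (V - e ` {..<q}) = V" "{..<q} \<union> {q..<card V} = {..<card V}"
    using assms(3) \<open>q \<le> card V\<close> by auto
  ultimately show ?thesis
    using assms(2) by (intro exI[of _ h]) (auto simp: h_def)
qed

subsection \<open>Finite fields of arbitrary size\<close>

text \<open>Fields are carried by sets inside one type: the required size depends on
  \<open>d\<close>, on which no type can depend.\<close>

locale finite_subfield =
  fixes F :: "'a :: field set"
  assumes finite_F: "finite F"
    and zero: "0 \<in> F" and one: "1 \<in> F"
    and add: "x \<in> F \<Longrightarrow> y \<in> F \<Longrightarrow> x + y \<in> F"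
    and uminus: "x \<in> F \<Longrightarrow> - x \<in> F"
    and mult: "x \<in> F \<Longrightarrow> y \<in> F \<Longrightarrow> x * y \<in> F"
    and inverse: "x \<in> F \<Longrightarrow> inverse x \<in> F"
begin

lemma diff: "x \<in> F \<Longrightarrow> y \<in> F \<Longrightarrow> x - y \<in> F"
  using add[of x "- y"] uminus by simp

lemma sum_mem: "(\<And>i. i \<in> I \<Longrightarrow> f i \<in> F) \<Longrightarrow> sum f I \<in> F"
  by (induction I rule: infinite_finite_induct) (auto intro: zero add)

lemma prod_mem: "(\<And>i. i \<in> I \<Longrightarrow> f i \<in> F) \<Longrightarrow> prod f I \<in> F"
  by (induction I rule: infinite_finite_induct) (auto intro: one mult)

end

text \<open>The \<open>m\<close>-fold Frobenius map is additive and multiplicative, so its fixed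
  points form a field. They are the roots of X^(2^m) - X, which has distinct linear factors over an
  algebraically closed field.\<close>

lemma finite_subfield_frobenius_fixed:
  fixes m :: nat
  assumes "CHAR('a :: alg_closed_field) = 2" "m > 0"
  defines "F \<equiv> {x :: 'a. x ^ (2 ^ m) = x}"
  shows "finite_subfield F" and "card F = 2 ^ m"
proof -
  have frob: "(x + y) ^ (2 ^ m) = x ^ (2 ^ m) + y ^ (2 ^ m)" for x y :: 'a
    using assms(1) by (intro freshmans_dream') auto
  have two: "(2 :: 'a) = 0"
    using of_nat_CHAR[where 'a = 'a] assms(1) by simp
  define P :: "'a poly" where "P = monom 1 (2 ^ m) - monom 1 1"
  have "(1::nat) < 2 ^ m" using assms(2) by (intro one_less_power) auto
  then have deg: "degree P = 2 ^ m"
    unfolding P_def diff_conv_add_uminus by (subst degree_add_eq_left) (auto simp: degree_monom_eq)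
  then have "P \<noteq> 0" by (metis degree_0 power_not_zero zero_neq_numeral)
  have roots: "F = {x. poly P x = 0}"
    by (auto simp: F_def P_def poly_monom)
  \<comment> \<open>The derivative of X^(2^m) vanishes in characteristic 2 because
    \<open>m > 0\<close>. So \<open>P\<close> shares no root with its derivative, and all its roots
    are simple.\<close>
  have pderiv: "pderiv P = - 1"
    using two \<open>m > 0\<close>
    by (simp add: P_def pderiv_diff pderiv_monom monom_0 power_0_left one_pCons)
  have fin: "finite F"
    using poly_roots_finite[OF \<open>P \<noteq> 0\<close>] roots by simp
  show "finite_subfield F"
  proof
    show "- x \<in> F" if "x \<in> F" for x
    proof -
      have "x + x = 0" by (simp only: mult_2[symmetric] two mult_zero_left)
      then have "- x = x" by (rule minus_unique)
      then show ?thesis using that by (simp only:)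
    qed
  qed (fact fin, simp_all add: F_def frob power_mult_distrib power_inverse)
  obtain A where A: "size A = degree P" "P = smult (lead_coeff P) (\<Prod>x\<in>#A. [:-x, 1:])"
    using alg_closed_imp_factorization[OF \<open>P \<noteq> 0\<close>] by blast
  have "count A x \<le> 1" for x
  proof (rule ccontr)
    assume "\<not> count A x \<le> 1"
    then have "x \<in># A" by (metis count_inI le0)
    then obtain A' where A': "A = add_mset x A'"
      by (metis multi_member_split)
    with \<open>\<not> count A x \<le> 1\<close> have "x \<in># A'" by (auto intro: count_inI)
    then obtain B where B: "A = add_mset x (add_mset x B)"
      using A' by (metis multi_member_split)
    define R where "R = smult (lead_coeff P) (\<Prod>x\<in>#B. [:-x, 1:])"
    have "P = [:-x, 1:] * ([:-x, 1:] * R)"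
      by (subst A(2)) (simp only: B R_def image_mset_add_mset prod_mset.add_mset mult_smult_right)
    then have "poly (pderiv P) x = 0"
      by (simp only: pderiv_mult) simp
    then show False using pderiv by simp
  qed
  then have "count A x = (if x \<in># A then 1 else 0)" for x
    by (metis le_antisym count_greater_eq_one_iff not_in_iff)
  then have "A = mset_set (set_mset A)"
    by (intro multiset_eqI) (simp add: count_mset_set')
  from arg_cong[OF this, of size] have "card (set_mset A) = size A"
    by simp
  moreover have "poly (\<Prod>x\<in>#B. [:-x, 1:]) a = 0 \<longleftrightarrow> a \<in># B" for a :: 'a and B
    by (induction B) auto
  from this[of A] have "poly P a = 0 \<longleftrightarrow> a \<in># A" for a
    using \<open>P \<noteq> 0\<close> by (subst A(2)) (simp only: poly_smult mult_eq_0_iff leading_coeff_0_iff simp_thms)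
  then have "F = set_mset A"
    using roots by auto
  ultimately show "card F = 2 ^ m"
    using A(1) deg by (simp only:)
qed

text \<open>Supplies enough evaluation points for the Reed--Solomon code. \<open>Suc n\<close> keeps
  the exponent positive even for \<open>n = 0\<close>.\<close>

lemma ex_finite_subfield:
  "\<exists>F :: bit alg_closure set. finite_subfield F \<and> n \<le> card F"
proof -
  have "CHAR(bit) = 2"
  proof (rule CHAR_eqI)
    show "2 dvd n" if "of_nat n = (0 :: bit)" for n
      using that even_of_nat[of n, where 'a = bit] by simp
  qed (simp add: bit_2_eq_0)
  then have char: "CHAR(bit alg_closure) = 2"
    by (simp only: CHAR_alg_closure)
  define F where "F = {x :: bit alg_closure. x ^ (2 ^ Suc n) = x}"
  have "finite_subfield F" "card F = 2 ^ Suc n"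
    unfolding F_def by (intro finite_subfield_frobenius_fixed char zero_less_Suc)+
  moreover have "n \<le> 2 ^ Suc n"
    using less_exp[of "Suc n"] by linarith
  ultimately show ?thesis by metis
qed

subsection \<open>Linear MDS codes\<close>

text \<open>
  Only the values of \<open>f \<in> E\<close> on \<open>{..<d}\<close> are meaningful; by \<open>E_cong\<close> the others are arbitrary.
\<close>

locale linear_mds_code = finite_subfield F for F :: "'a :: field set" +
  fixes d k :: nat and E :: "(nat \<Rightarrow> 'a) set"
  assumes E_mem: "f \<in> E \<Longrightarrow> i < d \<Longrightarrow> f i \<in> F"
    and E_comb: "finite K \<Longrightarrow> (\<And>r. r \<in> K \<Longrightarrow> u r \<in> E) \<Longrightarrow> (\<And>r. r \<in> K \<Longrightarrow> a r \<in> F) \<Longrightarrow>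
      (\<lambda>i. \<Sum>r\<in>K. a r * u r i) \<in> E"
    and E_cong: "f \<in> E \<Longrightarrow> (\<And>i. i < d \<Longrightarrow> g i = f i) \<Longrightarrow> g \<in> E"
    and E_basis: "K \<subseteq> {..<d} \<Longrightarrow> card K = k \<Longrightarrow>
      \<exists>u. \<forall>r\<in>K. u r \<in> E \<and> (\<forall>i\<in>K. u r i = (if i = r then 1 else 0))"
    and E_unique: "K \<subseteq> {..<d} \<Longrightarrow> card K = k \<Longrightarrow> f \<in> E \<Longrightarrow> \<forall>i\<in>K. f i = 0 \<Longrightarrow> i < d \<Longrightarrow> f i = 0"

text \<open>Lagrange interpolation provides the bases, and the bound on the number of roots gives
  uniqueness. Membership in \<open>F\<close> is asked of the values, not of the coefficients;
  \<open>0 < k\<close> admits the zero polynomial.\<close>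

lemma (in finite_subfield) ex_linear_mds_code:
  assumes d: "d \<le> card F" and k: "0 < k" "k \<le> d"
  shows "\<exists>E. linear_mds_code F d k E"
proof -
  obtain \<alpha> where \<alpha>: "inj_on \<alpha> {..<d}" "\<alpha> ` {..<d} \<subseteq> F"
    using card_le_inj[of "{..<d}" F] finite_F d by auto
  have \<alpha>_mem: "\<alpha> i \<in> F" if "i < d" for i using \<alpha>(2) that by auto
  \<comment> \<open>the Reed--Solomon code\<close>
  define E where "E = {f. \<exists>P. degree P < k \<and> (\<forall>i<d. f i = poly P (\<alpha> i) \<and> f i \<in> F)}"
  have "linear_mds_code F d k E"
  proof unfold_locales
    fix f i assume "f \<in> E" "i < d"
    then show "f i \<in> F" by (auto simp: E_def)
  next
    fix K :: "nat set" and u and a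
    assume K: "finite K" "\<And>r. r \<in> K \<Longrightarrow> u r \<in> E" "\<And>r. r \<in> K \<Longrightarrow> a r \<in> F"
    have "\<forall>r\<in>K. \<exists>P. degree P < k \<and> (\<forall>i<d. u r i = poly P (\<alpha> i) \<and> u r i \<in> F)"
      using K(2) by (simp add: E_def)
    then obtain P where P: "\<And>r. r \<in> K \<Longrightarrow> degree (P r) < k"
      "\<And>r i. r \<in> K \<Longrightarrow> i < d \<Longrightarrow> u r i = poly (P r) (\<alpha> i) \<and> u r i \<in> F"
      by metis
    have "degree (\<Sum>r\<in>K. smult (a r) (P r)) < k"
      using P(1) k(1) by (intro degree_sum_less) (auto intro: le_less_trans[OF degree_smult_le])
    moreover have "(\<Sum>r\<in>K. a r * u r i) = poly (\<Sum>r\<in>K. smult (a r) (P r)) (\<alpha> i)"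
      "(\<Sum>r\<in>K. a r * u r i) \<in> F" if "i < d" for i
    proof -
      show "(\<Sum>r\<in>K. a r * u r i) = poly (\<Sum>r\<in>K. smult (a r) (P r)) (\<alpha> i)"
        using P(2)[OF _ that] by (simp add: poly_sum)
      show "(\<Sum>r\<in>K. a r * u r i) \<in> F"
        using P(2)[OF _ that] K(3) by (intro sum_mem mult) blast+
    qed
    ultimately show "(\<lambda>i. \<Sum>r\<in>K. a r * u r i) \<in> E"
      unfolding E_def by blast
  next
    fix f g assume "f \<in> E" "\<And>i. i < d \<Longrightarrow> g i = f i"
    then show "g \<in> E" by (auto simp: E_def)
  next
    fix K assume K: "K \<subseteq> {..<d}" "card K = k"
    have fin: "finite K" using K(1) finite_subset by blast
    \<comment> \<open>Lagrange polynomials for the nodes \<open>\<alpha> s\<close> with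
      \<open>s \<in> K\<close>.\<close>
    define P where "P r = (\<Prod>s\<in>K - {r}. smult (inverse (\<alpha> r - \<alpha> s)) [:- \<alpha> s, 1:])" for r
    have P: "poly (P r) x = (\<Prod>s\<in>K - {r}. inverse (\<alpha> r - \<alpha> s) * (x - \<alpha> s))" for r x
      by (simp add: P_def poly_prod algebra_simps)
    have "(\<lambda>i. poly (P r) (\<alpha> i)) \<in> E" if r: "r \<in> K" for r
    proof -
      have "degree (P r) \<le> (\<Sum>s\<in>K - {r}. degree (smult (inverse (\<alpha> r - \<alpha> s)) [:- \<alpha> s, 1:]))"
        unfolding P_def using degree_prod_sum_le fin
        by (metis (mono_tags, lifting) comp_apply finite_Diff sum.cong)
      also have "\<dots> \<le> (\<Sum>s\<in>K - {r}. 1)"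
        by (intro sum_mono) simp
      also have "\<dots> < k"
        using r K(2) fin k(1) by (simp add: card_Diff_singleton)
      finally have "degree (P r) < k" .
      moreover have "poly (P r) (\<alpha> i) \<in> F" if "i < d" for i
        unfolding P using r K(1) that
        by (intro prod_mem mult inverse diff \<alpha>_mem) auto
      ultimately show ?thesis by (auto simp: E_def)
    qed
    moreover have "poly (P r) (\<alpha> i) = (if i = r then 1 else 0)" if "r \<in> K" "i \<in> K" for r i
    proof (cases "i = r")
      case True
      have "\<alpha> r \<noteq> \<alpha> s" if "s \<in> K - {r}" for s
        using \<alpha>(1) K(1) \<open>r \<in> K\<close> that by (auto dest!: inj_onD)
      then show ?thesis using True by (simp add: P)
    next
      case False
      then show ?thesis using that fin by (auto simp: P)
    qed
    ultimately show "\<exists>u. \<forall>r\<in>K. u r \<in> E \<and> (\<forall>i\<in>K. u r i = (if i = r then 1 else 0))"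
      by (intro exI[of _ "\<lambda>r i. poly (P r) (\<alpha> i)"]) auto
  next
    fix K f i assume K: "K \<subseteq> {..<d}" "card K = k" and f: "f \<in> E" "\<forall>i\<in>K. f i = 0" and "i < d"
    from f(1) obtain P where P: "degree P < k" "\<forall>i<d. f i = poly P (\<alpha> i)"
      by (auto simp: E_def)
    have "P = 0"
    proof (rule ccontr)
      assume "P \<noteq> 0"
      have "\<alpha> ` K \<subseteq> {x. poly P x = 0}" using f(2) P(2) K(1) by fastforce
      then have "card (\<alpha> ` K) \<le> degree P"
        using card_mono[OF poly_roots_finite[OF \<open>P \<noteq> 0\<close>]] card_poly_roots_bound[OF \<open>P \<noteq> 0\<close>]
        by (meson order_trans)
      then show False
        using P(1) K card_image[OF inj_on_subset[OF \<alpha>(1) K(1)]] by simp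
    qed
    then show "f i = 0" using P(2) \<open>i < d\<close> by simp
  qed
  then show ?thesis ..
qed

section \<open>Vector-valued words with components in the code\<close>

context linear_mds_code
begin

text \<open>\<open>K\<close> is an information set, and the \<open>u r\<close> are the rows of a
  generator matrix that is the identity on \<open>K\<close>.\<close>

definition systematic :: "nat set \<Rightarrow> (nat \<Rightarrow> nat \<Rightarrow> 'a) \<Rightarrow> bool" where
  "systematic K u \<longleftrightarrow> K \<subseteq> {..<d} \<and> card K = k \<and>
     (\<forall>r\<in>K. u r \<in> E \<and> (\<forall>i\<in>K. u r i = (if i = r then 1 else 0)))"

lemma ex_systematic: "K \<subseteq> {..<d} \<Longrightarrow> card K = k \<Longrightarrow> \<exists>u. systematic K u"
  unfolding systematic_def using E_basis by blast

lemma systematic_finite: "systematic K u \<Longrightarrow> finite K"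
  unfolding systematic_def using finite_subset by blast

lemma systematic_mem: "systematic K u \<Longrightarrow> r \<in> K \<Longrightarrow> i < d \<Longrightarrow> u r i \<in> F"
  unfolding systematic_def using E_mem by blast

lemma E_diff: "f \<in> E \<Longrightarrow> g \<in> E \<Longrightarrow> (\<lambda>i. f i - g i) \<in> E"
  using E_comb[of "{..<2::nat}" "\<lambda>r. if r = 0 then f else g" "\<lambda>r. if r = 0 then 1 else - 1"]
  by (simp add: one uminus numeral_2_eq_2)

lemma E_zero: "(\<lambda>i. 0) \<in> E"
  using E_comb[of "{}"] by simp

lemma systematic_sum:
  assumes "systematic K u" "i \<in> K"
  shows "(\<Sum>r\<in>K. u r i * w r) = w i"
proof -
  have "(\<Sum>r\<in>K. u r i * w r) = (\<Sum>r\<in>K. if r = i then w r else 0)"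
    using assms by (intro sum.cong) (auto simp: systematic_def)
  then show ?thesis using assms systematic_finite by simp
qed

text \<open>Both sides are codewords in \<open>i\<close>, and they agree on the information set
  \<open>K\<close>.\<close>

lemma E_expand:
  assumes u: "systematic K u" and f: "f \<in> E" and i: "i < d"
  shows "f i = (\<Sum>r\<in>K. u r i * f r)"
proof -
  have "(\<lambda>i. \<Sum>r\<in>K. f r * u r i) \<in> E"
    using u f systematic_finite[OF u] by (intro E_comb) (auto simp: systematic_def E_mem)
  from E_diff[OF f this] have "(\<lambda>i. f i - (\<Sum>r\<in>K. f r * u r i)) \<in> E" .
  moreover have "f j - (\<Sum>r\<in>K. f r * u r j) = 0" if "j \<in> K" for j
    using systematic_sum[OF u that, of f] by (simp add: mult.commute)
  ultimately have "f i - (\<Sum>r\<in>K. f r * u r i) = 0"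
    using E_unique[of K] u i unfolding systematic_def by blast
  then show ?thesis by (simp add: mult.commute)
qed

text \<open>If every side is the same space \<open>V\<close>, this is the tensor product of
  \<open>E\<close> with \<open>V\<close>; varying sides cut out boxes.\<close>

definition words :: "(nat \<Rightarrow> ('b \<Rightarrow> 'a) set) \<Rightarrow> (nat \<Rightarrow> 'b \<Rightarrow> 'a) set" where
  "words G = {x \<in> PiE {..<d} G. \<forall>p. (\<lambda>i. x i p) \<in> E}"

lemma words_Int: "(\<And>i. i < d \<Longrightarrow> H i \<subseteq> G i) \<Longrightarrow> words G \<inter> PiE {..<d} H = words H"
  using PiE_mono[of "{..<d}" H G] by (auto simp: words_def)

text \<open>Only the difference must have components in \<open>E\<close>, so that this also serves
  translates, whose words need not.\<close>

lemma words_eqI: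
  assumes "K \<subseteq> {..<d}" "card K = k" "x \<in> extensional {..<d}" "y \<in> extensional {..<d}"
    and E: "\<And>p. (\<lambda>i. x i p - y i p) \<in> E" and eq: "\<forall>i\<in>K. x i = y i"
  shows "x = y"
proof (rule extensionalityI[OF assms(3,4)])
  fix i assume "i \<in> {..<d}"
  then have "x i p - y i p = 0" for p
    using E_unique[OF assms(1,2) E[of p]] eq by auto
  then show "x i = y i" by (intro ext) simp
qed

text \<open>The sides are closed under systematic encoding; they need not be linear, so
  \<open>block 1 c\<close> qualifies as well.\<close>

definition spanned :: "(nat \<Rightarrow> ('b \<Rightarrow> 'a) set) \<Rightarrow> bool" where
  "spanned G \<longleftrightarrow> (\<forall>K u w i. systematic K u \<longrightarrow> w \<in> Pi K G \<longrightarrow> i < d \<longrightarrow>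
     (\<lambda>p. \<Sum>r\<in>K. u r i * w r p) \<in> G i)"

lemma words_ex:
  assumes "spanned G" and val: "\<And>i. i < d \<Longrightarrow> G i \<subseteq> UNIV \<rightarrow> F"
    and K: "K \<subseteq> {..<d}" "card K = k" and v: "v \<in> Pi K G"
  shows "\<exists>x\<in>words G. \<forall>i\<in>K. x i = v i"
proof -
  obtain u where u: "systematic K u" using ex_systematic[OF K] ..
  define x where "x = (\<lambda>i\<in>{..<d}. \<lambda>p. \<Sum>r\<in>K. u r i * v r p)"
  have x_K: "x i = v i" if "i \<in> K" for i
  proof -
    have "i < d" using that K(1) by auto
    then show ?thesis unfolding x_def using systematic_sum[OF u that] by auto
  qed
  have "x \<in> PiE {..<d} G"
    unfolding x_def restrict_PiE_iff using assms(1) u v unfolding spanned_def by blast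
  moreover have "(\<lambda>i. x i p) \<in> E" for p
  proof (rule E_cong)
    have "v r p \<in> F" if "r \<in> K" for r
    proof -
      have "r < d" "v r \<in> G r" using v K(1) that by auto
      then show ?thesis using val by blast
    qed
    then show "(\<lambda>i. \<Sum>r\<in>K. v r p * u r i) \<in> E"
      using u systematic_finite[OF u] by (intro E_comb) (auto simp: systematic_def)
  qed (simp add: x_def mult.commute)
  ultimately show ?thesis
    unfolding words_def using x_K by blast
qed

lemma words_mds:
  assumes "spanned G" "\<And>i. i < d \<Longrightarrow> G i \<subseteq> UNIV \<rightarrow> F"
  shows "mds k d G (words G)"
proof (rule mdsI)
  show "words G \<subseteq> PiE {..<d} G" by (auto simp: words_def)
  show "x = y" if "K \<subseteq> {..<d}" "card K = k" "x \<in> words G" "y \<in> words G" "\<forall>i\<in>K. x i = y i" for K x y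
    using that E_diff by (intro words_eqI[OF that(1,2) _ _ _ that(5)]) (auto simp: words_def PiE_iff)
qed (rule words_ex[OF assms])

text \<open>The code to switch in. As \<open>z\<close> will be an encoded word, whose components are
  in general not in \<open>E\<close>, this generally differs from \<open>words\<close> on the same
  box.\<close>

definition translates :: "(nat \<Rightarrow> 'b \<Rightarrow> 'a) \<Rightarrow> (nat \<Rightarrow> ('b \<Rightarrow> 'a) set) \<Rightarrow> (nat \<Rightarrow> 'b \<Rightarrow> 'a) set" where
  "translates z G = (\<lambda>x. \<lambda>i\<in>{..<d}. \<lambda>p. z i p + x i p) ` words G"

lemma translates_mds:
  assumes G: "spanned G" "\<And>i. i < d \<Longrightarrow> G i \<subseteq> UNIV \<rightarrow> F"
    and H: "\<And>i. i < d \<Longrightarrow> H i = (\<lambda>v p. z i p + v p) ` G i"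
  shows "mds k d H (translates z G)"
proof (rule mdsI)
  show "translates z G \<subseteq> PiE {..<d} H"
  proof
    fix y assume "y \<in> translates z G"
    then obtain x where "x \<in> words G" and y: "y = (\<lambda>i\<in>{..<d}. \<lambda>p. z i p + x i p)"
      by (auto simp: translates_def)
    then have "x i \<in> G i" if "i < d" for i
      using that by (auto simp: words_def)
    then show "y \<in> PiE {..<d} H"
      unfolding y restrict_PiE_iff using H by auto
  qed
next
  fix K v assume K: "K \<subseteq> {..<d}" "card K = k" and v: "v \<in> Pi K H"
  have vG: "(\<lambda>i p. v i p - z i p) \<in> Pi K G"
  proof
    fix i assume "i \<in> K"
    then have "i < d" "v i \<in> H i" using v K(1) by auto
    then have "v i \<in> (\<lambda>v p. z i p + v p) ` G i" by (simp only: H)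
    then show "(\<lambda>p. v i p - z i p) \<in> G i" by auto
  qed
  obtain x where x: "x \<in> words G" "\<forall>i\<in>K. x i = (\<lambda>p. v i p - z i p)"
    using words_ex[OF G K vG] by blast
  then have "\<forall>i\<in>K. (\<lambda>i\<in>{..<d}. \<lambda>p. z i p + x i p) i = v i"
    using K(1) by auto
  then show "\<exists>x\<in>translates z G. \<forall>i\<in>K. x i = v i"
    unfolding translates_def using x(1) by blast
next
  fix K x y
  assume K: "K \<subseteq> {..<d}" "card K = k" and "x \<in> translates z G" "y \<in> translates z G" and eq: "\<forall>i\<in>K. x i = y i"
  then obtain x' y' where xy: "x' \<in> words G" "x = (\<lambda>i\<in>{..<d}. \<lambda>p. z i p + x' i p)"
    "y' \<in> words G" "y = (\<lambda>i\<in>{..<d}. \<lambda>p. z i p + y' i p)"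
    by (auto simp: translates_def)
  show "x = y"
  proof (rule words_eqI[OF K _ _ _ eq])
    fix p
    have "(\<lambda>i. x' i p - y' i p) \<in> E"
      using xy(1,3) by (intro E_diff) (auto simp: words_def)
    then show "(\<lambda>i. x i p - y i p) \<in> E"
      by (rule E_cong) (simp add: xy)
  qed (simp_all only: xy restrict_extensional)
qed

subsection \<open>Boxes around codewords\<close>

text \<open>
  The representations of \<open>f \<mapsto> z * f i\<close> on the code \<open>E\<close> by coefficient vectors: for \<open>z = 0\<close> this is
  the dual code, for \<open>z = 1\<close> its translate by the \<open>i\<close>-th unit vector.
\<close>

definition functionals :: "'a \<Rightarrow> nat \<Rightarrow> (nat \<Rightarrow> 'a) set" where
  "functionals z i = {m. (\<forall>j<d. m j \<in> F) \<and> (\<forall>f\<in>E. (\<Sum>j<d. m j * f j) = z * f i)}"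

text \<open>
  Vectors over \<open>F\<close> are indexed by pairs (coordinate, letter), so that the letter \<open>a\<close> at coordinate
  \<open>j\<close> is encoded by the unit vector at \<open>(j, a)\<close>. The linear combination of the encoded letters of \<open>c\<close>
  with coefficients \<open>m\<close> is \<open>place c m\<close>.
\<close>

definition place :: "(nat \<Rightarrow> nat) \<Rightarrow> (nat \<Rightarrow> 'a) \<Rightarrow> nat \<times> nat \<Rightarrow> 'a" where
  "place c m = (\<lambda>(j, a). if j < d \<and> c j = a then m j else 0)"

abbreviation unit :: "nat \<Rightarrow> nat \<Rightarrow> 'a" where
  "unit i \<equiv> \<lambda>j. if j = i then 1 else 0"

text \<open>For \<open>z = 0\<close> this is \<open>L c\<close>, the same for all \<open>i\<close>;
  for \<open>z = 1\<close> it is \<open>e i (c i) + L c\<close>, the side of the box at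
  \<open>i\<close>.\<close>

definition block :: "'a \<Rightarrow> (nat \<Rightarrow> nat) \<Rightarrow> nat \<Rightarrow> (nat \<times> nat \<Rightarrow> 'a) set" where
  "block z c i = place c ` functionals z i"

text \<open>The space \<open>V\<close>; vanishing off the finite index set keeps it finite.\<close>

definition alphabet :: "nat \<Rightarrow> (nat \<times> nat \<Rightarrow> 'a) set" where
  "alphabet q = {v. \<forall>p. (p \<in> {..<d} \<times> {..<q} \<longrightarrow> v p \<in> F) \<and> (p \<notin> {..<d} \<times> {..<q} \<longrightarrow> v p = 0)}"

lemma finite_alphabet: "finite (alphabet q)"
  unfolding alphabet_def by (intro finite_set_of_finite_funs finite_F) simp

lemma alphabet_zero: "v \<in> alphabet q \<Longrightarrow> p \<notin> {..<d} \<times> {..<q} \<Longrightarrow> v p = 0"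
  unfolding alphabet_def by blast

lemma alphabet_subset: "alphabet q \<subseteq> UNIV \<rightarrow> F"
proof (intro subsetI Pi_I)
  show "v p \<in> F" if "v \<in> alphabet q" for v p
  proof (cases "p \<in> {..<d} \<times> {..<q}")
    case True
    then show ?thesis using that unfolding alphabet_def by blast
  next
    case False
    then have "v p = 0" using alphabet_zero[OF that] by blast
    then show ?thesis using zero by simp
  qed
qed

lemma block_subset: "block z c i \<subseteq> UNIV \<rightarrow> F"
  by (auto simp: block_def functionals_def place_def zero split: prod.split)

lemma block_subset_alphabet:
  assumes "c \<in> cube q d"
  shows "block z c i \<subseteq> alphabet q"
proof
  fix v assume "v \<in> block z c i"
  then obtain m where m: "v = place c m" "\<And>j. j < d \<Longrightarrow> m j \<in> F"
    by (auto simp: block_def functionals_def)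
  then show "v \<in> alphabet q"
    using assms zero by (auto simp: place_def alphabet_def cube_def PiE_iff)
qed

lemma spanned_alphabet: "spanned (\<lambda>_. alphabet q)"
  unfolding spanned_def
proof (intro allI impI)
  fix K u w i assume u: "systematic K u" and w: "w \<in> K \<rightarrow> alphabet q" and i: "i < d"
  have "w r p \<in> F" if "r \<in> K" for r p
    using w that alphabet_subset by blast
  then have "(\<Sum>r\<in>K. u r i * w r p) \<in> F" for p
    using systematic_mem[OF u] i by (intro sum_mem mult) auto
  moreover have "(\<Sum>r\<in>K. u r i * w r p) = 0" if "p \<notin> {..<d} \<times> {..<q}" for p
  proof (intro sum.neutral ballI)
    fix r assume "r \<in> K"
    then show "u r i * w r p = 0" using alphabet_zero[OF _ that, of "w r"] w by auto
  qed
  ultimately show "(\<lambda>p. \<Sum>r\<in>K. u r i * w r p) \<in> alphabet q"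
    unfolding alphabet_def by blast
qed

text \<open>By \<open>E_expand\<close>, \<open>f i\<close> is a fixed linear combination of the
  \<open>f r\<close>. The same combination of representations of evaluation at the \<open>r\<close>
  represents evaluation at \<open>i\<close>, with the common factor \<open>z\<close>.\<close>

lemma spanned_block: "spanned (block z c)"
  unfolding spanned_def
proof (intro allI impI)
  fix K u w i assume u: "systematic K u" and w: "w \<in> Pi K (block z c)" and i: "i < d"
  have "\<forall>r\<in>K. \<exists>m. m \<in> functionals z r \<and> w r = place c m"
    using w by (fastforce simp: block_def)
  then obtain m where m: "\<And>r. r \<in> K \<Longrightarrow> m r \<in> functionals z r" "\<And>r. r \<in> K \<Longrightarrow> w r = place c (m r)"
    by metis
  let ?m = "\<lambda>j. \<Sum>r\<in>K. u r i * m r j"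
  have "?m \<in> functionals z i"
    unfolding functionals_def
  proof (intro CollectI conjI allI impI ballI)
    fix j assume "j < d"
    then show "?m j \<in> F"
      using systematic_mem[OF u] i m(1) by (intro sum_mem mult) (auto simp: functionals_def)
  next
    fix f assume f: "f \<in> E"
    have "(\<Sum>j<d. ?m j * f j) = (\<Sum>j<d. \<Sum>r\<in>K. u r i * (m r j * f j))"
      by (simp add: sum_distrib_right mult.assoc)
    also have "\<dots> = (\<Sum>r\<in>K. u r i * (\<Sum>j<d. m r j * f j))"
      by (subst sum.swap) (simp add: sum_distrib_left)
    also have "\<dots> = (\<Sum>r\<in>K. u r i * (z * f r))"
      using m(1) f by (intro sum.cong) (auto simp: functionals_def)
    also have "\<dots> = z * (\<Sum>r\<in>K. u r i * f r)"
      by (simp add: sum_distrib_left mult.left_commute)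
    also have "\<dots> = z * f i" using E_expand[OF u f i] by simp
    finally show "(\<Sum>j<d. ?m j * f j) = z * f i" .
  qed
  moreover have "(\<lambda>p. \<Sum>r\<in>K. u r i * w r p) = place c ?m"
    using m(2) by (intro ext) (auto simp: place_def split: prod.split)
  ultimately show "(\<lambda>p. \<Sum>r\<in>K. u r i * w r p) \<in> block z c i"
    unfolding block_def by blast
qed

text \<open>The unit vector at \<open>i\<close> represents evaluation at \<open>i\<close>, and two
  representations differ by a dual word.\<close>

lemma block_translate:
  assumes "i < d"
  shows "block 1 c i = (\<lambda>v p. place c (unit i) p + v p) ` block 0 c i"
proof (intro equalityI subsetI)
  have sum_unit: "(\<Sum>j<d. unit i j * f j) = f i" for f :: "nat \<Rightarrow> 'a"
    using assms by (simp add: if_distrib[of "\<lambda>x. x * _"] cong: if_cong)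
  {
    fix v assume "v \<in> block 1 c i"
    then obtain m where m: "m \<in> functionals 1 i" "v = place c m" by (auto simp: block_def)
    have "(\<lambda>j. m j - unit i j) \<in> functionals 0 i"
      using m(1) sum_unit by (auto simp: functionals_def left_diff_distrib sum_subtractf intro!: diff one zero)
    moreover have "v = (\<lambda>p. place c (unit i) p + place c (\<lambda>j. m j - unit i j) p)"
      by (auto simp: m(2) place_def split: prod.split)
    ultimately show "v \<in> (\<lambda>v p. place c (unit i) p + v p) ` block 0 c i"
      unfolding block_def by blast
  }
  fix v assume "v \<in> (\<lambda>v p. place c (unit i) p + v p) ` block 0 c i"
  then obtain m where m: "m \<in> functionals 0 i" "v = (\<lambda>p. place c (unit i) p + place c m p)"
    by (auto simp: block_def)
  have "(\<lambda>j. unit i j + m j) \<in> functionals 1 i"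
    using m(1) sum_unit by (auto simp: functionals_def distrib_right sum.distrib intro!: add one zero)
  moreover have "v = place c (\<lambda>j. unit i j + m j)"
    by (auto simp: m(2) place_def split: prod.split)
  ultimately show "v \<in> block 1 c i"
    unfolding block_def by blast
qed

text \<open>
  A common element is supported where \<open>c\<close> and \<open>c'\<close> agree, so it cannot represent evaluation at \<open>i\<close>:
  some codeword is \<open>1\<close> at \<open>i\<close> and vanishes on all these fewer than \<open>k\<close> coordinates.
\<close>

lemma block_disjoint:
  assumes i: "i < d" "c i \<noteq> c' i" and close: "card {j \<in> {..<d}. c j = c' j} < k" and "k \<le> d"
  shows "block 1 c i \<inter> block 1 c' i = {}"
proof (rule ccontr)
  assume "block 1 c i \<inter> block 1 c' i \<noteq> {}"
  then obtain m m' where m: "m \<in> functionals 1 i" "place c m = place c' m'"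
    by (auto simp: block_def)
  define A where "A = {j \<in> {..<d}. c j = c' j}"
  \<comment> \<open>At the index \<open>(j, c j)\<close> the vector \<open>place c' m'\<close>
    vanishes whenever \<open>c j \<noteq> c' j\<close>.\<close>
  have m0: "m j = 0" if "j < d" "j \<notin> A" for j
    using fun_cong[OF m(2), of "(j, c j)"] that by (auto simp: place_def A_def split: if_splits)
  \<comment> \<open>Fewer than \<open>k\<close> agreements leave room for \<open>i\<close> in an
    information set \<open>K\<close>; its basis word \<open>u i\<close> is the required
    codeword.\<close>
  have "insert i A \<subseteq> {..<d}" "card (insert i A) \<le> k"
    using i(1) close card_insert_le_m1 by (auto simp: A_def card_insert_if)
  then obtain K where K: "insert i A \<subseteq> K" "K \<subseteq> {..<d}" "card K = k"
    using exists_subset_between[of "insert i A" k "{..<d}"] \<open>k \<le> d\<close> by auto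
  obtain u where u: "systematic K u" using ex_systematic[OF K(2,3)] ..
  then have f: "u i \<in> E" "\<And>j. j \<in> K \<Longrightarrow> u i j = unit i j"
    using K(1) by (auto simp: systematic_def)
  have "m j * u i j = 0" if "j < d" for j
  proof (cases "j \<in> A")
    case True
    then have "j \<noteq> i" "j \<in> K" using i(2) K(1) by (auto simp: A_def)
    then show ?thesis using f(2) by simp
  qed (simp add: m0 that)
  then have "(\<Sum>j<d. m j * u i j) = 0" by (intro sum.neutral) auto
  moreover have "(\<Sum>j<d. m j * u i j) = 1"
    using m(1) f K(1) by (auto simp: functionals_def)
  ultimately show False by simp
qed

lemma ex_mds_extension:
  assumes C: "C \<subseteq> cube q d" and "k \<le> d"
    and close: "\<And>c c'. c \<in> C \<Longrightarrow> c' \<in> C \<Longrightarrow> c \<noteq> c' \<Longrightarrow> card {j \<in> {..<d}. c j = c' j} < k"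
  shows "\<exists>M. mds k d (\<lambda>_. alphabet q) M \<and> (\<forall>c\<in>C. (\<lambda>i\<in>{..<d}. place c (unit i)) \<in> M)"
proof -
  define S where "S c = translates (\<lambda>i. place c (unit i)) (block 0 c)" for c
  define M where "M = words (\<lambda>_. alphabet q)"
  define N where "N = M - (\<Union>c\<in>C. PiE {..<d} (block 1 c)) \<union> (\<Union>c\<in>C. S c)"
  have "mds k d (\<lambda>_. alphabet q) N"
    unfolding N_def
  proof (rule mds_switch)
    show "mds k d (\<lambda>_. alphabet q) M"
      unfolding M_def by (rule words_mds[OF spanned_alphabet alphabet_subset])
  next
    fix c assume "c \<in> C"
    then have c: "c \<in> cube q d" using C by blast
    show sub: "block 1 c i \<subseteq> alphabet q" for i by (rule block_subset_alphabet[OF c])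
    \<comment> \<open>The big code meets the box in \<open>words (block 1 c)\<close>, which is MDS
      because the sides are spanned.\<close>
    show "mds k d (block 1 c) (M \<inter> PiE {..<d} (block 1 c))"
      unfolding M_def words_Int[OF sub] by (rule words_mds[OF spanned_block block_subset])
    show "mds k d (block 1 c) (S c)"
      unfolding S_def by (rule translates_mds[OF spanned_block block_subset block_translate])
  next
    fix c c' K assume c: "c \<in> C" "c' \<in> C" "c \<noteq> c'" and K: "K \<subseteq> {..<d}" "card K = k"
    have "\<not> K \<subseteq> {j \<in> {..<d}. c j = c' j}"
      using close[OF c] K(2) card_mono[of "{j \<in> {..<d}. c j = c' j}" K] by auto
    then obtain i where "i \<in> K" "i < d" "c i \<noteq> c' i" using K(1) by auto
    then show "\<exists>i\<in>K. block 1 c i \<inter> block 1 c' i = {}"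
      using block_disjoint close[OF c] \<open>k \<le> d\<close> by blast
  qed
  moreover have "(\<lambda>i\<in>{..<d}. place c (unit i)) \<in> N" if "c \<in> C" for c
  proof -
    \<comment> \<open>The zero word lies in \<open>words (block 0 c)\<close>, so its translate, the
      encoded word, lies in \<open>S c\<close>.\<close>
    have "(\<lambda>j. 0) \<in> functionals 0 i" "place c (\<lambda>j. 0) = (\<lambda>p. 0)" for i
      by (auto simp: functionals_def zero place_def)
    then have "(\<lambda>p. 0) \<in> block 0 c i" for i
      unfolding block_def by (metis imageI)
    then have "(\<lambda>i\<in>{..<d}. \<lambda>p. 0) \<in> words (block 0 c)"
      using E_cong[OF E_zero] by (auto simp: words_def)
    then have "(\<lambda>i\<in>{..<d}. place c (unit i)) \<in> S c"
      unfolding S_def translates_def by (rule rev_image_eqI) auto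
    then show ?thesis using that by (auto simp: N_def)
  qed
  ultimately show ?thesis by blast
qed

end

section \<open>Assembly and return to the original letters\<close>

theorem theorem1:
  fixes q d t :: nat and C :: "(nat \<Rightarrow> nat) set"
  assumes "q \<ge> 1" and "d \<ge> 1"
    and "is_code q d (t + 1) C"
  shows "\<exists>q' \<ge> q. \<exists>M. is_MDS t d q' M \<and> C \<subseteq> M"
proof -
  have C: "C \<subseteq> cube q d" and ne: "distances d C \<noteq> {}" and Min: "Min (distances d C) = t + 1"
    using assms(3) by (auto simp: is_code_def)
  have agree: "hamming d x y + card {j \<in> {..<d}. x j = y j} = d" for x y
    using card_Un_disjoint[of "{j \<in> {..<d}. x j \<noteq> y j}" "{j \<in> {..<d}. x j = y j}"]
    by (simp add: hamming_def Int_def Un_def conj_disj_distribL[symmetric] flip: lessThan_def)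
  have "distances d C \<subseteq> {..d}"
    using agree by (auto simp: distances_def) (metis le_add1)
  then have fin: "finite (distances d C)" using finite_subset by blast
  \<comment> \<open>The minimum is attained by two words, so \<open>t + 1 \<le> d\<close>. This
    makes \<open>k\<close> positive, as the Reed--Solomon code requires.\<close>
  have "t + 1 \<in> distances d C" using Min_in[OF fin ne] Min by simp
  with \<open>distances d C \<subseteq> {..d}\<close> have "t < d" by auto
  define k where "k = d - t"
  have k: "0 < k" "k \<le> d" "k + t = d" using \<open>t < d\<close> by (auto simp: k_def)
  have close: "card {j \<in> {..<d}. c j = c' j} < k" if "c \<in> C" "c' \<in> C" "c \<noteq> c'" for c c'
  proof -
    have "t + 1 \<le> hamming d c c'"
      using Min_le[OF fin] that Min by (auto simp: distances_def)
    then show ?thesis using agree[of c c'] k(3) by linarith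
  qed
  obtain F :: "bit alg_closure set" where F: "finite_subfield F" "d \<le> card F"
    using ex_finite_subfield by blast
  obtain E where "linear_mds_code F d k E"
    using finite_subfield.ex_linear_mds_code[OF F k(1,2)] by blast
  then interpret linear_mds_code F d k E .
  obtain M where M: "mds k d (\<lambda>_. alphabet q) M" "\<forall>c\<in>C. (\<lambda>i\<in>{..<d}. place c (unit i)) \<in> M"
    using ex_mds_extension[OF C k(2) close] by blast
  define e :: "nat \<Rightarrow> nat \<Rightarrow> nat \<times> nat \<Rightarrow> bit alg_closure"
    where "e i a = (\<lambda>p. if p = (i, a) then 1 else 0)" for i a
  have e_place: "place c (unit i) = e i (c i)" if "i < d" for c i
    using that by (auto simp: place_def e_def split: prod.split)
  have inj: "inj_on (e i) {..<q}" for i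
    by (rule inj_onI) (metis e_def prod.inject zero_neq_one)
  have e_alphabet: "e i ` {..<q} \<subseteq> alphabet q" if "i < d" for i
    using that by (auto simp: e_def alphabet_def one zero)
  define n where "n = card (alphabet q)"
  \<comment> \<open>The numbering depends on the coordinate, since the letter \<open>a\<close> is
    encoded by a different vector \<open>e i a\<close> at each \<open>i\<close>.\<close>
  have "\<forall>i\<in>{..<d}. \<exists>h. bij_betw h (alphabet q) {..<n} \<and> (\<forall>a<q. h (e i a) = a)"
    unfolding n_def using bij_betw_extend_inj[OF finite_alphabet inj e_alphabet] by blast
  then obtain h where h: "\<And>i. i < d \<Longrightarrow> bij_betw (h i) (alphabet q) {..<n}"
    "\<And>i a. i < d \<Longrightarrow> a < q \<Longrightarrow> h i (e i a) = a"
    by (metis lessThan_iff)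
  \<comment> \<open>Coordinate 0 exists because \<open>d \<ge> 1\<close>; its encoded letters alone
    are \<open>q\<close> distinct elements.\<close>
  have "q \<le> n"
    using card_mono[OF finite_alphabet e_alphabet[of 0]] assms(2) card_image[OF inj, of 0]
    by (simp add: n_def)
  moreover have "is_MDS t d n ((\<lambda>x. \<lambda>i\<in>{..<d}. h i (x i)) ` M)"
    by (rule is_MDS_image[OF M(1) h(1) k(3)])
  moreover have "c \<in> (\<lambda>x. \<lambda>i\<in>{..<d}. h i (x i)) ` M" if "c \<in> C" for c
  proof (rule image_eqI)
    show "(\<lambda>i\<in>{..<d}. place c (unit i)) \<in> M" using M(2) that by blast
    have "c \<in> cube q d" using that C by blast
    then show "c = (\<lambda>i\<in>{..<d}. h i ((\<lambda>i\<in>{..<d}. place c (unit i)) i))"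
      by (intro extensionalityI[of _ "{..<d}"]) (auto simp: cube_def PiE_iff e_place h(2))
  qed
  ultimately show ?thesis by blast
qed

end
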